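(* Let $(S,+)$ be a commutative cancellative semigroup with at least three elements and let $G=S-S$. Let $u,v\in\mathbb{N}\cup\{\omega\}$ and let $A$ be a $u\times v$ matrix with entries from $\mathbb{Z}$ (with finitely many nonzero entries in each row). Define a $u\times(2\cdot v)$ matrix $C$ by $c_{i,2\cdot j}=a_{i,j}$ and $c_{i,2\cdot j+1}=-a_{i,j}$ for $i<u$, $j<v$. Then $$\{A\vec x:\vec x\in G^v\}=\{C\vec y:\vec y\in(S\setminus\{0\})^{2\cdot v}\}.$$ Moreover, $A$ is weakly image partition regular over $S$ if and only if $C$ is image partition regular over $S$.
   Context: $\mathbb{N}$ is the set of positive integers and $\omega=\{0,1,2,\dots\}$; each $u\in\mathbb{N}$ is identified with $\{0,\dots,u-1\}$, and a $u\times v$ matrix has rows indexed by $u$ and columns by $v$. $2\cdot v$ is ordinal multiplication ($2v$ for finite $v$, $2\cdot\omega=\omega$). $G=S-S$ is the group of differences of $S$ (the group generated by $S$, in which $S$ embeds), $0$ denotes its identity, and $S\setminus\{0\}=S$ if $0\notin S$. Integer matrices act on $G$-vectors in the usual way. A finite colouring of a set is a function with finite range; monochromatic means the colouring is constant. A matrix $C$ with $w$ columns is image partition regular over $S$ if for every finite colouring of $S\setminus\{0\}$ there is $\vec y\in(S\setminus\{0\})^w$ with the entries of $C\vec y$ in $S\setminus\{0\}$ and monochromatic. $A$ with $v$ columns is weakly image partition regular over $S$ if for every finite colouring of $S\setminus\{0\}$ there is $\vec x\in G^v$ with the entries of $A\vec x$ in $S\setminus\{0\}$ and monochromatic. *)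

theory Defs
  imports Main "HOL-Library.FuncSet" "HOL-Library.Extended_Nat"
begin

text \<open>
  A commutative cancellative semigroup is a type of sort
  \<open>{ab_semigroup_add, cancel_semigroup_add}\<close>. The class \<open>cancel_ab_semigroup_add\<close> is not used
  because it also demands a subtraction satisfying further axioms.
\<close>

definition diff_rel :: "'s::{ab_semigroup_add, cancel_semigroup_add} \<times> 's \<Rightarrow> 's \<times> 's \<Rightarrow> bool"
  where "diff_rel p q \<longleftrightarrow> fst p + snd q = fst q + snd p"

lemma equivp_diff_rel:
  "equivp (diff_rel :: 's::{ab_semigroup_add, cancel_semigroup_add} \<times> 's \<Rightarrow> 's \<times> 's \<Rightarrow> bool)"
proof (rule equivpI)
  show "reflp (diff_rel :: 's \<times> 's \<Rightarrow> _)" by (simp add: reflp_def diff_rel_def)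
  show "symp (diff_rel :: 's \<times> 's \<Rightarrow> _)" by (simp add: symp_def diff_rel_def)
  show "transp (diff_rel :: 's \<times> 's \<Rightarrow> _)"
  proof (rule transpI)
    fix p q r :: "'s \<times> 's"
    assume "diff_rel p q" "diff_rel q r"
    then have 1: "fst p + snd q = fst q + snd p" and 2: "fst q + snd r = fst r + snd q"
      by (simp_all add: diff_rel_def)
    have "snd q + (fst p + snd r) = (fst p + snd q) + snd r" by (simp add: ac_simps)
    also have "\<dots> = (fst q + snd r) + snd p" by (simp add: 1 ac_simps)
    also have "\<dots> = snd q + (fst r + snd p)" by (simp add: 2 ac_simps)
    finally show "diff_rel p r" by (simp add: diff_rel_def)
  qed
qed

text \<open>The group of differences: the class of \<open>(a, b)\<close> stands for \<open>a - b\<close>. All diagonal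
  pairs are equivalent, so the choice of \<open>undefined\<close> as representative in zero is immaterial.\<close>

quotient_type (overloaded) 's diff_group =
  "'s::{ab_semigroup_add, cancel_semigroup_add} \<times> 's" / diff_rel
  by (rule equivp_diff_rel)

instantiation diff_group :: ("{ab_semigroup_add, cancel_semigroup_add}") ab_group_add
begin

lift_definition zero_diff_group :: "'a diff_group" is "(undefined, undefined)" .

lift_definition plus_diff_group :: "'a diff_group \<Rightarrow> 'a diff_group \<Rightarrow> 'a diff_group"
  is "\<lambda>p q. (fst p + fst q, snd p + snd q)"
proof -
  fix p p' q q' :: "'a \<times> 'a"
  assume "diff_rel p p'" "diff_rel q q'"
  then have 1: "fst p + snd p' = fst p' + snd p" and 2: "fst q + snd q' = fst q' + snd q"
    by (simp_all add: diff_rel_def)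
  have "(fst p + fst q) + (snd p' + snd q') = (fst p + snd p') + (fst q + snd q')"
    by (simp add: ac_simps)
  also have "\<dots> = (fst p' + fst q') + (snd p + snd q)"
    unfolding 1 2 by (simp add: ac_simps)
  finally show "diff_rel (fst p + fst q, snd p + snd q) (fst p' + fst q', snd p' + snd q')"
    by (simp add: diff_rel_def)
qed

lift_definition uminus_diff_group :: "'a diff_group \<Rightarrow> 'a diff_group"
  is "\<lambda>p. (snd p, fst p)"
  by (simp add: diff_rel_def add.commute)

definition minus_diff_group :: "'a diff_group \<Rightarrow> 'a diff_group \<Rightarrow> 'a diff_group"
  where "minus_diff_group a b = a + - b"

instance
proof
  fix a b c :: "'a diff_group"
  show "a + b + c = a + (b + c)" by transfer (simp add: diff_rel_def ac_simps)
  show "a + b = b + a" by transfer (simp add: diff_rel_def ac_simps)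
  show "0 + a = a" by transfer (simp add: diff_rel_def ac_simps)
  show "- a + a = 0" by transfer (simp add: diff_rel_def ac_simps)
  show "a - b = a + - b" by (rule minus_diff_group_def)
qed

end

lift_definition diff_embed :: "'s::{ab_semigroup_add, cancel_semigroup_add} \<Rightarrow> 's diff_group"
  is "\<lambda>s. (s + s, s)" .

lemma diff_embed_add: "diff_embed (a + b) = diff_embed a + diff_embed b"
  by transfer (simp add: diff_rel_def ac_simps)

lemma inj_diff_embed: "inj (diff_embed :: 's::{ab_semigroup_add, cancel_semigroup_add} \<Rightarrow> _)"
proof (rule injI)
  fix a b :: 's
  assume "diff_embed a = diff_embed b"
  then have "(a + a) + b = (b + b) + a" by transfer (simp add: diff_rel_def)
  then have "(a + b) + a = (a + b) + b" by (simp add: ac_simps)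
  then show "a = b" by simp
qed

lemma diff_group_differences:
  "{a - b |a b. a \<in> range diff_embed \<and> b \<in> range diff_embed} =
    (UNIV :: 's::{ab_semigroup_add, cancel_semigroup_add} diff_group set)"
proof -
  have "\<exists>a b. x = diff_embed a + - diff_embed b" for x :: "'s diff_group"
  proof transfer
    fix p :: "'s \<times> 's"
    show "\<exists>a b. diff_rel p (fst (a + a, a) + fst (snd (b + b, b), fst (b + b, b)),
        snd (a + a, a) + snd (snd (b + b, b), fst (b + b, b)))"
      by (rule exI[of _ "fst p"], rule exI[of _ "snd p"]) (simp add: diff_rel_def ac_simps)
  qed
  then have "\<exists>a b. x = diff_embed a - diff_embed b" for x :: "'s diff_group"
    by simp
  then show ?thesis by blast
qed

definition int_mult :: "int \<Rightarrow> 'g::ab_group_add \<Rightarrow> 'g"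
  where "int_mult k x = (if k \<ge> 0 then (\<Sum>_<nat k. x) else - (\<Sum>_<nat (- k). x))"

text \<open>
  The sizes in \<open>\<nat> \<union> {\<omega>}\<close> are the nonzero elements of type \<open>enat\<close>, with \<open>\<infinity>\<close> in the role
  of \<open>\<omega>\<close>; in particular \<open>2 * \<infinity> = \<infinity>\<close>, as for the ordinal product \<open>2 \<cdot> \<omega>\<close>.
  Vectors of length \<open>v\<close> are extensional functions on \<open>idx v\<close>.
\<close>

definition idx :: "enat \<Rightarrow> nat set"
  where "idx n = {i. enat i < n}"

text \<open>
  Only meaningful for matrices with finitely many nonzero entries in each row.
\<close>

definition mat_vec ::
  "enat \<Rightarrow> enat \<Rightarrow> (nat \<Rightarrow> nat \<Rightarrow> int) \<Rightarrow> (nat \<Rightarrow> 'g::ab_group_add) \<Rightarrow> nat \<Rightarrow> 'g"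
  where "mat_vec u v A x =
    (\<lambda>i\<in>idx u. \<Sum>j\<in>{j \<in> idx v. A i j \<noteq> 0}. int_mult (A i j) (x j))"

definition monochromatic :: "('g \<Rightarrow> nat) \<Rightarrow> 'g set \<Rightarrow> bool"
  where "monochromatic \<chi> X \<longleftrightarrow> (\<exists>c. \<forall>x\<in>X. \<chi> x = c)"

text \<open>
  In both notions below \<open>S\<close> is a subsemigroup of the ambient group. Since only colourings with
  finite range matter, it is no restriction to take colours in \<open>nat\<close>.
\<close>

definition image_partition_regular ::
  "'g::ab_group_add set \<Rightarrow> enat \<Rightarrow> enat \<Rightarrow> (nat \<Rightarrow> nat \<Rightarrow> int) \<Rightarrow> bool"
  where "image_partition_regular S u w C \<longleftrightarrow>
    (\<forall>\<chi> :: 'g \<Rightarrow> nat. finite (\<chi> ` (S - {0})) \<longrightarrow>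
      (\<exists>y \<in> idx w \<rightarrow>\<^sub>E (S - {0}).
        mat_vec u w C y ` idx u \<subseteq> S - {0} \<and> monochromatic \<chi> (mat_vec u w C y ` idx u)))"

definition weakly_image_partition_regular ::
  "'g::ab_group_add set \<Rightarrow> enat \<Rightarrow> enat \<Rightarrow> (nat \<Rightarrow> nat \<Rightarrow> int) \<Rightarrow> bool"
  where "weakly_image_partition_regular S u v A \<longleftrightarrow>
    (\<forall>\<chi> :: 'g \<Rightarrow> nat. finite (\<chi> ` (S - {0})) \<longrightarrow>
      (\<exists>x \<in> idx v \<rightarrow>\<^sub>E {a - b |a b. a \<in> S \<and> b \<in> S}.
        mat_vec u v A x ` idx u \<subseteq> S - {0} \<and> monochromatic \<chi> (mat_vec u v A x ` idx u)))"

end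

theory Submission
  imports Defs
begin

text \<open>
  Every \<open>g \<in> G\<close> is a difference of two nonzero elements of \<open>S\<close>: write \<open>g = a - b\<close> with
  \<open>a, b \<in> S\<close> and use one of the three elements to find \<open>s \<in> S\<close> different from \<open>-a\<close> and \<open>-b\<close>;
  then \<open>g = (a + s) - (b + s)\<close>. On the other hand \<open>C y = A x\<close> for
  \<open>x\<^sub>j = y\<^sub>2\<^sub>j - y\<^sub>2\<^sub>j\<^sub>+\<^sub>1\<close>, so both matrices have the same image, and each of the two regularity
  properties depends on the image only.
\<close>

lemma int_mult_uminus_left: "int_mult (- k) x = - int_mult k x"
  by (auto simp: int_mult_def)

lemma int_mult_diff_right: "int_mult k (x - y) = int_mult k x - int_mult k y"
  by (simp add: int_mult_def sum_subtractf)

lemma double_mem_idx_iff: "2 * j \<in> idx (2 * v) \<longleftrightarrow> j \<in> idx v"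
  by (cases v) (auto simp: idx_def numeral_eq_enat)

text \<open>For finite \<open>v\<close> the bound \<open>2 * v\<close> is even, so
  \<open>2 * j\<close> below it forces \<open>2 * j + 1\<close> below it as well. For
  \<open>v = \<infinity>\<close> both index sets are all of \<open>nat\<close>.\<close>

lemma Suc_double_mem_idx_iff: "Suc (2 * j) \<in> idx (2 * v) \<longleftrightarrow> j \<in> idx v"
  by (cases v) (auto simp: idx_def numeral_eq_enat)

text \<open>\<open>mat_vec\<close> sums over the support of a row. Negation preserves being nonzero,
  so the support of the doubled row consists of an even and an odd copy of the original one.\<close>

lemma nonzero_columns_doubled:
  assumes even: "\<And>j. j \<in> idx v \<Longrightarrow> c (2 * j) = a j"
    and odd: "\<And>j. j \<in> idx v \<Longrightarrow> c (Suc (2 * j)) = - a j"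
  shows "{k \<in> idx (2 * v). c k \<noteq> (0::int)} =
    (\<lambda>j. 2 * j) ` {j \<in> idx v. a j \<noteq> 0} \<union> (\<lambda>j. Suc (2 * j)) ` {j \<in> idx v. a j \<noteq> 0}"
    (is "?L = ?R")
proof (rule set_eqI)
  fix k :: nat
  consider j where "k = 2 * j" | j where "k = Suc (2 * j)"
    by (cases "even k") (auto elim: evenE oddE)
  then show "k \<in> ?L \<longleftrightarrow> k \<in> ?R"
  proof cases
    case (1 j)
    have "2 * j \<noteq> Suc (2 * j')" for j' by presburger
    with 1 even[of j] show ?thesis by (auto simp: double_mem_idx_iff)
  next
    case (2 j)
    have "Suc (2 * j) \<noteq> 2 * j'" for j' by presburger
    with 2 odd[of j] show ?thesis by (auto simp: Suc_double_mem_idx_iff)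
  qed
qed

text \<open>Columns \<open>2 * j\<close> and \<open>2 * j + 1\<close> of \<open>C\<close> together
  contribute \<open>A i j\<close> times \<open>y (2 * j) - y (2 * j + 1)\<close>, which is the
  contribution of column \<open>j\<close> of \<open>A\<close> to the image of
  \<open>x\<close>.\<close>

lemma mat_vec_doubled:
  fixes y :: "nat \<Rightarrow> 'g::ab_group_add"
  assumes fin: "\<And>i. i \<in> idx u \<Longrightarrow> finite {j \<in> idx v. A i j \<noteq> 0}"
    and even: "\<And>i j. i \<in> idx u \<Longrightarrow> j \<in> idx v \<Longrightarrow> C i (2 * j) = A i j"
    and odd: "\<And>i j. i \<in> idx u \<Longrightarrow> j \<in> idx v \<Longrightarrow> C i (Suc (2 * j)) = - A i j"
    and x: "\<And>j. j \<in> idx v \<Longrightarrow> x j = y (2 * j) - y (Suc (2 * j))"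
  shows "mat_vec u (2 * v) C y = mat_vec u v A x"
  unfolding mat_vec_def
proof (rule restrict_ext)
  fix i assume i: "i \<in> idx u"
  define J where "J = {j \<in> idx v. A i j \<noteq> 0}"
  have J: "finite J" "J \<subseteq> idx v" using fin[OF i] by (auto simp: J_def)
  let ?f = "\<lambda>k. int_mult (C i k) (y k)"
  have "{k \<in> idx (2 * v). C i k \<noteq> 0} = (\<lambda>j. 2 * j) ` J \<union> (\<lambda>j. Suc (2 * j)) ` J"
    unfolding J_def by (rule nonzero_columns_doubled) (simp_all add: even odd i)
  moreover have "(\<lambda>j. 2 * j) ` J \<inter> (\<lambda>j. Suc (2 * j)) ` J = {}"
    by (auto simp: double_not_eq_Suc_double)
  \<comment> \<open>Finiteness of \<open>J\<close> allows the split; a sum over an infinite set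
    would be 0 by default.\<close>
  ultimately have "sum ?f {k \<in> idx (2 * v). C i k \<noteq> 0} =
      sum ?f ((\<lambda>j. 2 * j) ` J) + sum ?f ((\<lambda>j. Suc (2 * j)) ` J)"
    using J by (simp add: sum.union_disjoint)
  \<comment> \<open>Both halves are reindexed by \<open>J\<close>, which pairs neighbouring
    columns.\<close>
  also have "\<dots> = (\<Sum>j\<in>J. ?f (2 * j) + ?f (Suc (2 * j)))"
    by (simp add: sum.reindex inj_on_def sum.distrib)
  also have "\<dots> = (\<Sum>j\<in>J. int_mult (A i j) (x j))"
    using J(2) i
    by (intro sum.cong) (auto simp: even odd x int_mult_uminus_left int_mult_diff_right)
  finally show "sum ?f {k \<in> idx (2 * v). C i k \<noteq> 0} =
      (\<Sum>j\<in>{j \<in> idx v. A i j \<noteq> 0}. int_mult (A i j) (x j))"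
    by (simp add: J_def)
qed

lemma difference_of_nonzero:
  fixes S :: "'g::ab_group_add set"
  assumes closed: "\<And>s t. s \<in> S \<Longrightarrow> t \<in> S \<Longrightarrow> s + t \<in> S"
    and three: "p \<in> S" "q \<in> S" "r \<in> S" "p \<noteq> q" "p \<noteq> r" "q \<noteq> r"
    and g: "g \<in> {a - b |a b. a \<in> S \<and> b \<in> S}"
  shows "\<exists>a \<in> S - {0}. \<exists>b \<in> S - {0}. g = a - b"
proof -
  obtain a b where ab: "a \<in> S" "b \<in> S" "g = a - b" using g by blast
  \<comment> \<open>Only two values are excluded, so one of \<open>p\<close>, \<open>q\<close>,
    \<open>r\<close> remains.\<close>
  obtain s where "s \<in> S" "s \<noteq> - a" "s \<noteq> - b" using three by metis
  then have "a + s \<in> S - {0}" "b + s \<in> S - {0}"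
    using ab closed by (auto simp: add_eq_0_iff)
  moreover have "g = (a + s) - (b + s)" using ab by simp
  ultimately show ?thesis by blast
qed

lemma image_doubled_eq:
  fixes S :: "'g::ab_group_add set"
  assumes closed: "\<And>s t. s \<in> S \<Longrightarrow> t \<in> S \<Longrightarrow> s + t \<in> S"
    and three: "p \<in> S" "q \<in> S" "r \<in> S" "p \<noteq> q" "p \<noteq> r" "q \<noteq> r"
    and fin: "\<And>i. i \<in> idx u \<Longrightarrow> finite {j \<in> idx v. A i j \<noteq> 0}"
    and even: "\<And>i j. i \<in> idx u \<Longrightarrow> j \<in> idx v \<Longrightarrow> C i (2 * j) = A i j"
    and odd: "\<And>i j. i \<in> idx u \<Longrightarrow> j \<in> idx v \<Longrightarrow> C i (Suc (2 * j)) = - A i j"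
  shows "mat_vec u v A ` (idx v \<rightarrow>\<^sub>E {a - b |a b. a \<in> S \<and> b \<in> S}) =
    mat_vec u (2 * v) C ` (idx (2 * v) \<rightarrow>\<^sub>E (S - {0}))"
proof (intro equalityI image_subsetI)
  let ?G = "{a - b |a b. a \<in> S \<and> b \<in> S}"
  fix x assume x: "x \<in> idx v \<rightarrow>\<^sub>E ?G"
  have "\<exists>a \<in> S - {0}. \<exists>b \<in> S - {0}. x j = a - b" if "j \<in> idx v" for j
    by (rule difference_of_nonzero[OF closed three PiE_mem[OF x that]])
  then obtain a b where
    ab: "\<And>j. j \<in> idx v \<Longrightarrow> a j \<in> S - {0} \<and> b j \<in> S - {0} \<and> x j = a j - b j"
    by metis
  \<comment> \<open>The chosen minuends go to the even positions and the subtrahends to the odd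
    ones; \<open>k div 2\<close> recovers \<open>j\<close> from either position.\<close>
  define y where
    "y = (\<lambda>k\<in>idx (2 * v). if even k then a (k div 2) else b (k div 2))"
  have half: "k div 2 \<in> idx v" if "k \<in> idx (2 * v)" for k
    using that double_mem_idx_iff[of "k div 2" v] Suc_double_mem_idx_iff[of "k div 2" v]
    by (cases "even k") auto
  have "y \<in> idx (2 * v) \<rightarrow>\<^sub>E (S - {0})"
    unfolding y_def restrict_PiE_iff using ab half by auto
  moreover have "mat_vec u (2 * v) C y = mat_vec u v A x"
    using fin even odd
    by (rule mat_vec_doubled)
      (auto simp: y_def ab double_mem_idx_iff Suc_double_mem_idx_iff)
  ultimately show "mat_vec u v A x \<in> mat_vec u (2 * v) C ` (idx (2 * v) \<rightarrow>\<^sub>E (S - {0}))"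
    by (intro image_eqI[of _ _ y]) simp_all
next
  let ?G = "{a - b |a b. a \<in> S \<and> b \<in> S}"
  fix y assume y: "y \<in> idx (2 * v) \<rightarrow>\<^sub>E (S - {0})"
  \<comment> \<open>Conversely, consecutive entries of \<open>y\<close> are subtracted, and a
    difference of elements of \<open>S\<close> lies in \<open>?G\<close>.\<close>
  define x where "x = (\<lambda>j\<in>idx v. y (2 * j) - y (Suc (2 * j)))"
  have "y (2 * j) \<in> S" "y (Suc (2 * j)) \<in> S" if "j \<in> idx v" for j
    using that PiE_mem[OF y] double_mem_idx_iff Suc_double_mem_idx_iff by blast+
  then have "x \<in> idx v \<rightarrow>\<^sub>E ?G"
    unfolding x_def restrict_PiE_iff by blast
  moreover have "mat_vec u (2 * v) C y = mat_vec u v A x"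
    using fin even odd by (rule mat_vec_doubled) (auto simp: x_def)
  ultimately show "mat_vec u (2 * v) C y \<in> mat_vec u v A ` (idx v \<rightarrow>\<^sub>E ?G)"
    by (intro image_eqI[of _ _ x]) simp_all
qed

theorem theorem1p5:
  fixes S G :: "'s::{ab_semigroup_add, cancel_semigroup_add} diff_group set"
    and u v :: enat
    and A C :: "nat \<Rightarrow> nat \<Rightarrow> int"
  assumes "\<exists>a b c :: 's. a \<noteq> b \<and> a \<noteq> c \<and> b \<noteq> c"
    and "S = range diff_embed"
    and "G = {a - b |a b. a \<in> S \<and> b \<in> S}"
    and "u \<noteq> 0" and "v \<noteq> 0"
    and "\<And>i. i \<in> idx u \<Longrightarrow> finite {j \<in> idx v. A i j \<noteq> 0}"
    and "\<And>i j. i \<in> idx u \<Longrightarrow> j \<in> idx v \<Longrightarrow> C i (2 * j) = A i j"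
    and "\<And>i j. i \<in> idx u \<Longrightarrow> j \<in> idx v \<Longrightarrow> C i (2 * j + 1) = - A i j"
  shows "{mat_vec u v A x |x. x \<in> idx v \<rightarrow>\<^sub>E G} =
      {mat_vec u (2 * v) C y |y. y \<in> idx (2 * v) \<rightarrow>\<^sub>E (S - {0})} \<and>
    (weakly_image_partition_regular S u v A \<longleftrightarrow> image_partition_regular S u (2 * v) C)"
proof -
  \<comment> \<open>\<open>S\<close> is the image of a homomorphism.\<close>
  have closed: "s + t \<in> S" if "s \<in> S" "t \<in> S" for s t
    using that assms(2) by (auto simp flip: diff_embed_add)
  obtain a b c :: 's where "a \<noteq> b" "a \<noteq> c" "b \<noteq> c"
    using assms(1) by blast
  then have three: "diff_embed a \<in> S" "diff_embed b \<in> S" "diff_embed c \<in> S"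
    "diff_embed a \<noteq> diff_embed b" "diff_embed a \<noteq> diff_embed c" "diff_embed b \<noteq> diff_embed c"
    using assms(2) inj_diff_embed by (auto dest: injD)
  have eq: "mat_vec u v A ` (idx v \<rightarrow>\<^sub>E G) =
      mat_vec u (2 * v) C ` (idx (2 * v) \<rightarrow>\<^sub>E (S - {0}))"
    unfolding assms(3) using closed three assms(6,7) assms(8)[folded Suc_eq_plus1]
    by (rule image_doubled_eq)
  \<comment> \<open>\<open>P\<close> is left arbitrary because the property required of the image
    vector will depend on the colouring.\<close>
  have ex: "(\<exists>x \<in> idx v \<rightarrow>\<^sub>E G. P (mat_vec u v A x)) \<longleftrightarrow>
      (\<exists>y \<in> idx (2 * v) \<rightarrow>\<^sub>E (S - {0}). P (mat_vec u (2 * v) C y))" for P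
    using arg_cong[OF eq, of "\<lambda>X. \<exists>z \<in> X. P z"] by (simp only: bex_simps)
  have "weakly_image_partition_regular S u v A \<longleftrightarrow> image_partition_regular S u (2 * v) C"
    unfolding weakly_image_partition_regular_def image_partition_regular_def
      assms(3)[symmetric]
    \<comment> \<open>Generalizing over \<open>\<chi>\<close> lets the rewriting happen below the
      quantifier over colourings.\<close>
    by (simp only: ex[of "\<lambda>z. z ` idx u \<subseteq> S - {0} \<and> monochromatic \<chi> (z ` idx u)" for \<chi>])
  with eq show ?thesis by (simp only: Setcompr_eq_image)
qed

end
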